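(* Let $\mathcal{N}$ and $\Sigma$ be finite nonempty sets with $\mathcal{N}\cap\Sigma=\emptyset$, let $Z\notin\mathcal{N}\cup\Sigma$, and let $W$ be the monoid built from $\Sigma$ and $\mathcal{N}$ as in the context. Let $H=\langle V,E,l\rangle$ be a transition diagram with set of vertices $V=\mathcal{N}\cup\{Z\}$ and a multiset of arcs $E$, whose elements are labeled with elements of the monoid $W$, satisfying the following conditions: a) If $A\in\mathcal{N}$ and $\overrightarrow{AZ}$ is an arc in $H$, then $l(\overrightarrow{AZ})=\langle a,\varepsilon\rangle$ for some $a\in\Sigma$; b) Let $A,B,C\in\mathcal{N}$. Then there exists an arc $\overrightarrow{AB}$ with label $l(\overrightarrow{AB})=\langle\varepsilon,C\rangle$ if and only if there exists an arc $\overrightarrow{ZC}$ with label $l(\overrightarrow{ZC})=\langle\varepsilon,C'\rangle$; c) $H$ contains no other arcs than those described in items a) and b). Let $S\in\mathcal{N}$. Denote by $\Pi_S$ the set of all walks in $H$ with start vertex $S$, final vertex $Z$ and having a label of the type $\langle\alpha,\varepsilon\rangle$, $\alpha\in\Sigma^+$. Then the language $$L(H,S)=\{\alpha\mid\exists\,\pi\in\Pi_S:\ l(\pi)=\langle\alpha,\varepsilon\rangle\}$$ generated by the transition diagram $H$ with the starting vertex $S$ is context-free.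
   Context: $\Sigma^*$ is the free monoid of words over $\Sigma$ with identity the empty word $\varepsilon$, and $\Sigma^+=\Sigma^*\setminus\{\varepsilon\}$. A language over $\Sigma$ is a subset of $\Sigma^*$. A context-free grammar is a triple consisting of a finite set $\mathcal{M}$ of nonterminals, a finite set $\Sigma$ of terminals disjoint from $\mathcal{M}$, and a finite set of productions $A\to\omega$ with $A\in\mathcal{M}$ and $\omega\in(\mathcal{M}\cup\Sigma)^*$. The language it generates from a starting symbol $S\in\mathcal{M}$ is the set of all words of $\Sigma^*$ derivable from $S$ by means of the productions, in the usual sense. A language is context-free if it is generated by some context-free grammar from some starting symbol. The label monoid $W$. Let $\mathcal{N}'=\{A'\mid A\in\mathcal{N}\}$ with $\mathcal{N}\cap\mathcal{N}'=\emptyset$. Let $T$ be the monoid with set of generators $\mathcal{N}\cup\mathcal{N}'$ and defining relations $AA'=\varepsilon$ for $A\in\mathcal{N}$, $A'\in\mathcal{N}'$ (the primed copy of $A$), where $\varepsilon$ also denotes the identity of $T$. Let $W=\Sigma^*\times T=\{\langle\alpha,\omega\rangle\mid\alpha\in\Sigma^*,\ \omega\in T\}$ with the operation $\langle\alpha_1,\omega_1\rangle\circ\langle\alpha_2,\omega_2\rangle=\langle\alpha_1\alpha_2,\omega_1\omega_2\rangle$ and identity $\langle\varepsilon,\varepsilon\rangle$. A transition diagram is a finite directed graph (its arcs form a multiset of ordered pairs of vertices) all of whose arcs are labeled by an element of a semigroup (here $W$). $\overrightarrow{AB}$ denotes an arc from $A$ to $B$, and $l$ is the labeling function. A walk is a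 non-empty alternating sequence $A_0\rho_0A_1\rho_1\ldots\rho_{t-1}A_t$ of vertices $A_i$ and arcs $\rho_i=\langle A_i,A_{i+1}\rangle$. The label $l(\pi)$ of a walk $\pi$ is the product of the labels of the arcs that make it up, taken in the order in which they are passed. *)

theory Defs
  imports "Graph_Theory.Graph_Theory" "HOL-Algebra.Group"
begin

section \<open>Context-free languages\<close>

text \<open>Nonterminals and terminals are kept disjoint by the two constructors.\<close>

datatype ('n, 't) symbol = NT 'n | Tm 't

record ('n, 't) cfg =
  nonterms :: "'n set"
  terms :: "'t set"
  prods :: "('n \<times> ('n, 't) symbol list) set"

definition wf_cfg :: "('n, 't) cfg \<Rightarrow> bool" where
  "wf_cfg G \<longleftrightarrow>
     finite (nonterms G) \<and> finite (terms G) \<and> finite (prods G) \<and>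
     prods G \<subseteq> nonterms G \<times> lists (NT ` nonterms G \<union> Tm ` terms G)"

definition derives_step ::
    "('n, 't) cfg \<Rightarrow> ('n, 't) symbol list \<Rightarrow> ('n, 't) symbol list \<Rightarrow> bool" where
  "derives_step G x y \<longleftrightarrow>
     (\<exists>u v A w. (A, w) \<in> prods G \<and> x = u @ [NT A] @ v \<and> y = u @ w @ v)"

definition cfg_lang :: "('n, 't) cfg \<Rightarrow> 'n \<Rightarrow> 't list set" where
  "cfg_lang G S = {w \<in> lists (terms G). (derives_step G)\<^sup>*\<^sup>* [NT S] (map Tm w)}"

text \<open>Since the set of nonterminals of a grammar is finite, taking nonterminals from the
  type \<^typ>\<open>nat\<close> is no restriction.\<close>

definition context_free :: "'t list set \<Rightarrow> bool" where
  "context_free L \<longleftrightarrow>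
     (\<exists>(G :: (nat, 't) cfg) S. wf_cfg G \<and> S \<in> nonterms G \<and> L = cfg_lang G S)"


section \<open>Monoids of words and monoid presentations\<close>

definition word_monoid :: "'a set \<Rightarrow> 'a list monoid" where
  "word_monoid X = \<lparr>carrier = lists X, mult = (@), one = []\<rparr>"

inductive_set pres_cong :: "'g set \<Rightarrow> ('g list \<times> 'g list) set \<Rightarrow> ('g list \<times> 'g list) set"
  for X :: "'g set" and R :: "('g list \<times> 'g list) set" where
  refl: "u \<in> lists X \<Longrightarrow> (u, u) \<in> pres_cong X R"
| sym: "(u, v) \<in> pres_cong X R \<Longrightarrow> (v, u) \<in> pres_cong X R"
| trans: "(u, v) \<in> pres_cong X R \<Longrightarrow> (v, w) \<in> pres_cong X R \<Longrightarrow> (u, w) \<in> pres_cong X R"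
| rel: "(r, s) \<in> R \<Longrightarrow> r \<in> lists X \<Longrightarrow> s \<in> lists X \<Longrightarrow> u \<in> lists X \<Longrightarrow> v \<in> lists X
    \<Longrightarrow> (u @ r @ v, u @ s @ v) \<in> pres_cong X R"

definition pres_class :: "'g set \<Rightarrow> ('g list \<times> 'g list) set \<Rightarrow> 'g list \<Rightarrow> 'g list set" where
  "pres_class X R u = pres_cong X R `` {u}"

definition pres_monoid :: "'g set \<Rightarrow> ('g list \<times> 'g list) set \<Rightarrow> 'g list set monoid" where
  "pres_monoid X R =
     \<lparr>carrier = lists X // pres_cong X R,
      mult = (\<lambda>P Q. \<Union>p\<in>P. \<Union>q\<in>Q. pres_class X R (p @ q)),
      one = pres_class X R []\<rparr>"

lemma pres_cong_in_lists:
  assumes "(u, v) \<in> pres_cong X R" shows "u \<in> lists X" and "v \<in> lists X"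
  using assms by (induction) auto

lemma equiv_pres_cong: "equiv (lists X) (pres_cong X R)"
proof (rule equivI)
  show "pres_cong X R \<subseteq> lists X \<times> lists X"
    by (auto dest: pres_cong_in_lists)
  show "refl_on (lists X) (pres_cong X R)"
    by (rule refl_onI) (auto intro: pres_cong.refl)
  show "Relation.sym (pres_cong X R)"
    by (rule symI) (rule pres_cong.sym)
  show "Relation.trans (pres_cong X R)"
    by (rule transI) (rule pres_cong.trans)
qed

lemma pres_cong_context:
  assumes "(u, v) \<in> pres_cong X R" "x \<in> lists X" "y \<in> lists X"
  shows "(x @ u @ y, x @ v @ y) \<in> pres_cong X R"
  using assms
proof (induction)
  case (refl u)
  then show ?case by (intro pres_cong.refl) auto
next
  case (sym u v)
  then show ?case by (blast intro: pres_cong.sym)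
next
  case (trans u v w)
  then show ?case by (blast intro: pres_cong.trans)
next
  case (rel r s u v)
  then show ?case
    using pres_cong.rel[of r s R X "x @ u" "v @ y"] by simp
qed

lemma pres_cong_append:
  assumes "(u, u') \<in> pres_cong X R" "(v, v') \<in> pres_cong X R"
  shows "(u @ v, u' @ v') \<in> pres_cong X R"
proof (rule pres_cong.trans)
  show "(u @ v, u' @ v) \<in> pres_cong X R"
    using pres_cong_context[OF assms(1), of "[]" v] pres_cong_in_lists[OF assms(2)] by simp
  show "(u' @ v, u' @ v') \<in> pres_cong X R"
    using pres_cong_context[OF assms(2), of u' "[]"] pres_cong_in_lists[OF assms(1)] by simp
qed

lemma pres_class_eq_iff:
  assumes "u \<in> lists X" "v \<in> lists X"
  shows "pres_class X R u = pres_class X R v \<longleftrightarrow> (u, v) \<in> pres_cong X R"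
  unfolding pres_class_def by (rule eq_equiv_class_iff[OF equiv_pres_cong assms])

lemma pres_mult_class:
  assumes "u \<in> lists X" "v \<in> lists X"
  shows "pres_class X R u \<otimes>\<^bsub>pres_monoid X R\<^esub> pres_class X R v = pres_class X R (u @ v)"
proof -
  have "pres_class X R (p @ q) = pres_class X R (u @ v)"
    if "p \<in> pres_class X R u" "q \<in> pres_class X R v" for p q
  proof -
    have "(u @ v, p @ q) \<in> pres_cong X R"
      using that by (intro pres_cong_append) (auto simp: pres_class_def)
    then show ?thesis
      by (metis pres_class_eq_iff pres_cong_in_lists)
  qed
  then have "(\<Union>p\<in>pres_class X R u. \<Union>q\<in>pres_class X R v. pres_class X R (p @ q))
      = (\<Union>p\<in>pres_class X R u. \<Union>q\<in>pres_class X R v. pres_class X R (u @ v))"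
    by (intro SUP_cong HOL.refl)
  moreover have "pres_class X R u \<noteq> {}" "pres_class X R v \<noteq> {}"
    using assms by (auto simp: pres_class_def intro: pres_cong.refl)
  ultimately show ?thesis
    unfolding pres_monoid_def by simp
qed

lemma carrier_pres_monoid: "carrier (pres_monoid X R) = pres_class X R ` lists X"
  by (auto simp: pres_monoid_def pres_class_def quotient_def)

lemma one_pres_monoid: "\<one>\<^bsub>pres_monoid X R\<^esub> = pres_class X R []"
  by (simp add: pres_monoid_def)

lemma monoid_pres_monoid: "monoid (pres_monoid X R)"
proof (rule monoidI)
  show "\<one>\<^bsub>pres_monoid X R\<^esub> \<in> carrier (pres_monoid X R)"
    unfolding carrier_pres_monoid one_pres_monoid by blast
next
  fix x y
  assume "x \<in> carrier (pres_monoid X R)" "y \<in> carrier (pres_monoid X R)"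
  then obtain u v where "u \<in> lists X" "v \<in> lists X" "x = pres_class X R u" "y = pres_class X R v"
    unfolding carrier_pres_monoid by blast
  then show "x \<otimes>\<^bsub>pres_monoid X R\<^esub> y \<in> carrier (pres_monoid X R)"
    by (metis pres_mult_class carrier_pres_monoid append_in_lists_conv imageI)
next
  fix x y z
  assume "x \<in> carrier (pres_monoid X R)" "y \<in> carrier (pres_monoid X R)"
    "z \<in> carrier (pres_monoid X R)"
  then obtain u v w where "u \<in> lists X" "v \<in> lists X" "w \<in> lists X"
    "x = pres_class X R u" "y = pres_class X R v" "z = pres_class X R w"
    unfolding carrier_pres_monoid by blast
  then show "x \<otimes>\<^bsub>pres_monoid X R\<^esub> y \<otimes>\<^bsub>pres_monoid X R\<^esub> z
      = x \<otimes>\<^bsub>pres_monoid X R\<^esub> (y \<otimes>\<^bsub>pres_monoid X R\<^esub> z)"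
    by (metis pres_mult_class append_in_lists_conv append_assoc)
next
  fix x
  assume "x \<in> carrier (pres_monoid X R)"
  then obtain u where "u \<in> lists X" "x = pres_class X R u"
    unfolding carrier_pres_monoid by blast
  then show "\<one>\<^bsub>pres_monoid X R\<^esub> \<otimes>\<^bsub>pres_monoid X R\<^esub> x = x"
    and "x \<otimes>\<^bsub>pres_monoid X R\<^esub> \<one>\<^bsub>pres_monoid X R\<^esub> = x"
    by (metis pres_mult_class one_pres_monoid lists.Nil append_Nil append_Nil2)+
qed

lemma monoid_word_monoid: "monoid (word_monoid X)"
  by (rule monoidI) (auto simp: word_monoid_def)


section \<open>The label monoid\<close>

text \<open>\<^term>\<open>Gen A\<close> is the generator \<open>A\<close>, and \<^term>\<open>Primed A\<close> is its primed copy.\<close>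

datatype 'a gen = Gen 'a | Primed 'a

definition T_gens :: "'a set \<Rightarrow> 'a gen set" where
  "T_gens N = Gen ` N \<union> Primed ` N"

definition T_rels :: "'a set \<Rightarrow> ('a gen list \<times> 'a gen list) set" where
  "T_rels N = {([Gen A, Primed A], []) | A. A \<in> N}"

definition T_monoid :: "'a set \<Rightarrow> 'a gen list set monoid" where
  "T_monoid N = pres_monoid (T_gens N) (T_rels N)"

definition T_elem :: "'a set \<Rightarrow> 'a gen \<Rightarrow> 'a gen list set" where
  "T_elem N g = pres_class (T_gens N) (T_rels N) [g]"

definition W_monoid :: "'a set \<Rightarrow> 'a set \<Rightarrow> ('a list \<times> 'a gen list set) monoid" where
  "W_monoid Sig N = word_monoid Sig \<times>\<times> T_monoid N"

lemma monoid_W_monoid: "monoid (W_monoid Sig N)"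
  unfolding W_monoid_def T_monoid_def
  by (rule DirProd_monoid[OF monoid_word_monoid monoid_pres_monoid])

lemma T_elem_in_carrier:
  assumes "A \<in> N"
  shows "T_elem N (Gen A) \<in> carrier (T_monoid N)" "T_elem N (Primed A) \<in> carrier (T_monoid N)"
  using assms by (auto simp: T_elem_def T_monoid_def carrier_pres_monoid T_gens_def)

lemma T_elem_relation:
  assumes "A \<in> N"
  shows "T_elem N (Gen A) \<otimes>\<^bsub>T_monoid N\<^esub> T_elem N (Primed A) = \<one>\<^bsub>T_monoid N\<^esub>"
proof -
  have "([Gen A, Primed A], []) \<in> pres_cong (T_gens N) (T_rels N)"
    using pres_cong.rel[of "[Gen A, Primed A]" "[]" "T_rels N" "T_gens N" "[]" "[]"] assms
    by (auto simp: T_rels_def T_gens_def)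
  then show ?thesis
    using assms
    by (simp add: T_elem_def T_monoid_def one_pres_monoid pres_mult_class pres_class_eq_iff
        T_gens_def)
qed


section \<open>Transition diagrams\<close>

text \<open>A \<^typ>\<open>('v, 'e) pre_digraph\<close> has its own arc objects, so several arcs
  (with equal or different labels) may join the same ordered pair of vertices.\<close>

definition transition_diagram :: "('w, 'm) monoid_scheme \<Rightarrow> ('v, 'e) pre_digraph \<Rightarrow> ('e \<Rightarrow> 'w) \<Rightarrow> bool" where
  "transition_diagram M H l \<longleftrightarrow> fin_digraph H \<and> (\<forall>e \<in> arcs H. l e \<in> carrier M)"

text \<open>A walk is given by the list of its arcs; the walk without arcs has the label \<^term>\<open>\<one>\<^bsub>M\<^esub>\<close>.\<close>

definition walk_label :: "('w, 'm) monoid_scheme \<Rightarrow> ('e \<Rightarrow> 'w) \<Rightarrow> 'e awalk \<Rightarrow> 'w" where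
  "walk_label M l p = foldr (\<lambda>e x. l e \<otimes>\<^bsub>M\<^esub> x) p \<one>\<^bsub>M\<^esub>"

definition accepting_walks ::
    "'a set \<Rightarrow> 'a set \<Rightarrow> 'a \<Rightarrow> ('a, 'e) pre_digraph \<Rightarrow> ('e \<Rightarrow> 'a list \<times> 'a gen list set) \<Rightarrow> 'a
      \<Rightarrow> 'e awalk set" where
  "accepting_walks Sig N Z H l S =
     {p. pre_digraph.awalk H S p Z \<and>
         (\<exists>\<alpha> \<in> lists Sig - {[]}. walk_label (W_monoid Sig N) l p = (\<alpha>, \<one>\<^bsub>T_monoid N\<^esub>))}"

definition diagram_lang ::
    "'a set \<Rightarrow> 'a set \<Rightarrow> 'a \<Rightarrow> ('a, 'e) pre_digraph \<Rightarrow> ('e \<Rightarrow> 'a list \<times> 'a gen list set) \<Rightarrow> 'a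
      \<Rightarrow> 'a list set" where
  "diagram_lang Sig N Z H l S =
     {\<alpha>. \<exists>p \<in> accepting_walks Sig N Z H l S.
           walk_label (W_monoid Sig N) l p = (\<alpha>, \<one>\<^bsub>T_monoid N\<^esub>)}"

text \<open>The condition ``for \<open>A, B, C \<in> N\<close>, there is an arc from \<open>A\<close> to \<open>B\<close> pushing \<open>C\<close> if and only if
  there is an arc from \<open>Z\<close> to \<open>C\<close> popping \<open>C\<close>'' is read for each \<open>C\<close>, with the endpoints \<open>A, B\<close> of
  the pushing arc existentially quantified. Quantifying universally over \<open>A\<close> and \<open>B\<close>
  instead would force every pair of vertices in \<open>N\<close> to be joined by a \<open>C\<close>-pushing arc as soon as
  one is; that reading is a special case:\<close>

lemma push_pop_universal_imp_existential:
  assumes "N \<noteq> {}"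
    and "\<forall>A\<in>N. \<forall>B\<in>N. \<forall>C\<in>N. push A B C \<longleftrightarrow> pop C"
  shows "\<forall>C\<in>N. (\<exists>A\<in>N. \<exists>B\<in>N. push A B C) \<longleftrightarrow> pop C"
  using assms by blast

end

theory Submission
  imports Defs
begin

text \<open>Take the grammar with nonterminals \<open>N\<close>, a production \<open>A \<rightarrow> a\<close> for every arc from \<open>A\<close> to
  \<open>Z\<close> labeled \<open>a\<close>, and a production \<open>A \<rightarrow> B C\<close> for every arc from \<open>A\<close> to \<open>B\<close> pushing \<open>C\<close>.
  The monoid \<open>T\<close> acts by partial maps on stacks over \<open>N\<close>, so along an accepting walk the stack
  returns to empty; a vertex \<open>A\<close> (or \<open>Z\<close>) together with the current stack \<open>C\<^sub>1 \<dots> C\<^sub>k\<close> corresponds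
  to the suffix \<open>A C\<^sub>1 \<dots> C\<^sub>k\<close> (or \<open>C\<^sub>1 \<dots> C\<^sub>k\<close>) of a left sentential form, and the walk traces a
  leftmost derivation. Conversely, the languages of the diagram from its various starting vertices
  are closed under the productions: a \<open>C\<close>-pushing arc, an accepting walk from \<open>B\<close>, a \<open>C\<close>-popping
  arc and an accepting walk from \<open>C\<close> concatenate to an accepting walk from \<open>A\<close>.\<close>

section \<open>Languages substituted into sentential forms, and derivations\<close>

fun form_lang :: "('n \<Rightarrow> 't list set) \<Rightarrow> ('n, 't) symbol list \<Rightarrow> 't list set" where
  "form_lang L [] = {[]}"
| "form_lang L (Tm a # x) = {a # w | w. w \<in> form_lang L x}"
| "form_lang L (NT A # x) = {u @ w | u w. u \<in> L A \<and> w \<in> form_lang L x}"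

lemma form_lang_append:
  "form_lang L (x @ y) = {u @ w | u w. u \<in> form_lang L x \<and> w \<in> form_lang L y}"
proof (induction L x rule: form_lang.induct)
  case (2 L a x)
  show ?case
    unfolding append_Cons form_lang.simps 2
    by (auto; metis append_Cons)
next
  case (3 L A x)
  show ?case
    unfolding append_Cons form_lang.simps 3
    by (auto; metis append_assoc)
qed simp

lemma form_lang_terminals: "form_lang L (map Tm w) = {w}"
  by (induction w) auto

text \<open>A step replaces some \<open>A\<close> by a right-hand side whose language lies in
  \<open>L A\<close>, so the language of the form can only shrink. For a terminal word
  \<open>y\<close> that language is a singleton, so the word lies in the language of
  \<open>x\<close>.\<close>

lemma form_lang_derives:
  assumes closed: "\<And>A w. (A, w) \<in> prods G \<Longrightarrow> form_lang L w \<subseteq> L A"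
    and "(derives_step G)\<^sup>*\<^sup>* x y"
  shows "form_lang L y \<subseteq> form_lang L x"
  using assms(2)
proof (induction rule: rtranclp_induct)
  case (step y z)
  obtain u v A w where "(A, w) \<in> prods G" "y = u @ [NT A] @ v" "z = u @ w @ v"
    using step.hyps(2) unfolding derives_step_def by blast
  moreover from this have "form_lang L w \<subseteq> L A"
    using closed by blast
  ultimately have "form_lang L z \<subseteq> form_lang L y"
    by (auto simp: form_lang_append) blast
  then show ?case
    using step.IH by blast
qed simp

lemma derives_step_context:
  assumes "derives_step G x y"
  shows "derives_step G (u @ x @ v) (u @ y @ v)"
  using assms unfolding derives_step_def by (metis append_assoc)

lemma derives_context:
  assumes "(derives_step G)\<^sup>*\<^sup>* x y"
  shows "(derives_step G)\<^sup>*\<^sup>* (u @ x @ v) (u @ y @ v)"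
  using assms
  by (induction rule: rtranclp_induct) (auto intro: derives_step_context rtranclp.rtrancl_into_rtrancl)

lemma derives_production:
  assumes "(A, w) \<in> prods G" and "(derives_step G)\<^sup>*\<^sup>* (w @ x) y"
  shows "(derives_step G)\<^sup>*\<^sup>* (NT A # x) y"
proof -
  have "derives_step G (NT A # x) (w @ x)"
    using assms(1) unfolding derives_step_def by (metis append_Cons append_Nil)
  then show ?thesis
    using assms(2) by simp
qed

section \<open>The action of \<open>T\<close> on stacks by partial maps\<close>

fun stack_run :: "'a gen list \<Rightarrow> 'a list \<Rightarrow> 'a list option" where
  "stack_run [] st = Some st"
| "stack_run (Gen A # u) st = stack_run u (A # st)"
| "stack_run (Primed A # u) [] = None"
| "stack_run (Primed A # u) (B # st) = (if A = B then stack_run u st else None)"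

lemma stack_run_append:
  "stack_run (u @ v) st = Option.bind (stack_run u st) (stack_run v)"
  by (induction u st rule: stack_run.induct) auto

text \<open>Pushing \<open>A\<close> and popping it at once changes no stack, so both sides of a
  defining relation act alike, and \<open>stack_run_append\<close> carries this into any context.
  The action thus depends only on the element of \<open>T\<close>.\<close>

lemma stack_run_cong:
  assumes "(u, v) \<in> pres_cong X (T_rels N)"
  shows "stack_run u st = stack_run v st"
  using assms
proof (induction arbitrary: st)
  case (rel r s u v)
  have "stack_run (r @ v) = stack_run (s @ v)"
    using rel.hyps(1) by (intro ext) (auto simp: T_rels_def)
  then show ?case
    by (simp add: stack_run_append)
qed simp_all

section \<open>Labels of walks in \<open>W\<close>\<close>

lemma walk_label_Nil: "walk_label M l [] = \<one>\<^bsub>M\<^esub>"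
  by (simp add: walk_label_def)

lemma walk_label_Cons: "walk_label M l (e # p) = l e \<otimes>\<^bsub>M\<^esub> walk_label M l p"
  by (simp add: walk_label_def)

lemma walk_label_closed:
  assumes "monoid M" and "\<And>e. e \<in> set p \<Longrightarrow> l e \<in> carrier M"
  shows "walk_label M l p \<in> carrier M"
  using assms(2)
  by (induction p)
    (auto simp: walk_label_Nil walk_label_Cons monoid.one_closed[OF assms(1)]
      monoid.m_closed[OF assms(1)])

lemma walk_label_append:
  assumes "monoid M" and "\<And>e. e \<in> set p \<union> set q \<Longrightarrow> l e \<in> carrier M"
  shows "walk_label M l (p @ q) = walk_label M l p \<otimes>\<^bsub>M\<^esub> walk_label M l q"
  using assms(2)
  by (induction p)
    (auto simp: walk_label_Nil walk_label_Cons monoid.l_one[OF assms(1)]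
      monoid.m_assoc[OF assms(1)] walk_label_closed[OF assms(1)])

lemma W_mult:
  "(u, x) \<otimes>\<^bsub>W_monoid Sig N\<^esub> (v, y) = (u @ v, x \<otimes>\<^bsub>T_monoid N\<^esub> y)"
  by (simp add: W_monoid_def word_monoid_def)

lemma W_one: "\<one>\<^bsub>W_monoid Sig N\<^esub> = ([], \<one>\<^bsub>T_monoid N\<^esub>)"
  by (simp add: W_monoid_def word_monoid_def)

lemma W_carrierE:
  assumes "x \<in> carrier (W_monoid Sig N)"
  obtains \<alpha> t where "\<alpha> \<in> lists Sig" "t \<in> lists (T_gens N)"
    "x = (\<alpha>, pres_class (T_gens N) (T_rels N) t)"
  using assms
  by (auto simp: W_monoid_def DirProd_def word_monoid_def T_monoid_def carrier_pres_monoid)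

lemma diagram_lang_iff:
  "\<alpha> \<in> diagram_lang Sig N Z H l S \<longleftrightarrow>
    \<alpha> \<in> lists Sig \<and> \<alpha> \<noteq> [] \<and>
    (\<exists>p. pre_digraph.awalk H S p Z \<and> walk_label (W_monoid Sig N) l p = (\<alpha>, \<one>\<^bsub>T_monoid N\<^esub>))"
  unfolding diagram_lang_def accepting_walks_def by auto

lemma pres_class_T_one: "pres_class (T_gens N) (T_rels N) [] = \<one>\<^bsub>T_monoid N\<^esub>"
  by (simp add: T_monoid_def one_pres_monoid)

lemma pres_class_T_Cons:
  assumes "g \<in> T_gens N" "t \<in> lists (T_gens N)"
  shows "T_elem N g \<otimes>\<^bsub>T_monoid N\<^esub> pres_class (T_gens N) (T_rels N) t =
    pres_class (T_gens N) (T_rels N) (g # t)"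
  using assms by (simp add: T_elem_def T_monoid_def pres_mult_class)

lemma stack_run_class:
  assumes "u \<in> lists (T_gens N)" "v \<in> lists (T_gens N)"
    and "pres_class (T_gens N) (T_rels N) u = pres_class (T_gens N) (T_rels N) v"
  shows "stack_run u st = stack_run v st"
  using assms by (meson pres_class_eq_iff stack_run_cong)

theorem theorem2:
  fixes N Sig :: "'a set" and Z S :: 'a
    and H :: "('a, 'e) pre_digraph" and l :: "'e \<Rightarrow> 'a list \<times> 'a gen list set"
  assumes "finite N" and "N \<noteq> {}" and "finite Sig" and "Sig \<noteq> {}"
    and "N \<inter> Sig = {}" and "Z \<notin> N \<union> Sig"
    and "transition_diagram (W_monoid Sig N) H l"
    and "verts H = N \<union> {Z}"
    and a: "\<forall>e \<in> arcs H. tail H e \<in> N \<and> head H e = Z \<longrightarrow>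
              (\<exists>a \<in> Sig. l e = ([a], \<one>\<^bsub>T_monoid N\<^esub>))"
    and b: "\<forall>C \<in> N.
              (\<exists>A \<in> N. \<exists>B \<in> N. \<exists>e \<in> arcs H.
                 tail H e = A \<and> head H e = B \<and> l e = ([], T_elem N (Gen C))) \<longleftrightarrow>
              (\<exists>e \<in> arcs H. tail H e = Z \<and> head H e = C \<and> l e = ([], T_elem N (Primed C)))"
    and c: "\<forall>e \<in> arcs H.
              (tail H e \<in> N \<and> head H e = Z) \<or>
              (\<exists>A \<in> N. \<exists>B \<in> N. \<exists>C \<in> N.
                 tail H e = A \<and> head H e = B \<and> l e = ([], T_elem N (Gen C))) \<or>
              (\<exists>C \<in> N. tail H e = Z \<and> head H e = C \<and> l e = ([], T_elem N (Primed C)))"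
    and "S \<in> N"
  shows "context_free (diagram_lang Sig N Z H l S)"
proof -
  let ?W = "W_monoid Sig N" and ?T = "T_monoid N"
  let ?cls = "pres_class (T_gens N) (T_rels N)"
  let ?L = "diagram_lang Sig N Z H l"
  interpret fin_digraph H
    using assms(7) by (simp add: transition_diagram_def)
  interpret W: monoid ?W by (rule monoid_W_monoid)
  interpret T: monoid ?T unfolding T_monoid_def by (rule monoid_pres_monoid)
  have lab: "l e \<in> carrier ?W" if "e \<in> arcs H" for e
    using that assms(7) by (simp add: transition_diagram_def)
  have ZN: "Z \<notin> N" using assms(6) by simp

  \<comment> \<open>Closure of the diagram languages under both kinds of production\<close>
  define letter where "letter A a \<longleftrightarrow>
    (\<exists>e \<in> arcs H. tail H e = A \<and> head H e = Z \<and> l e = ([a], \<one>\<^bsub>?T\<^esub>))" for A a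
  define push where "push A B C \<longleftrightarrow>
    (\<exists>e \<in> arcs H. tail H e = A \<and> head H e = B \<and> l e = ([], T_elem N (Gen C)))" for A B C

  have letter_lang: "[a] \<in> ?L A" if "A \<in> N" "a \<in> Sig" "letter A a" for A a
  proof -
    obtain e where e: "e \<in> arcs H" "tail H e = A" "head H e = Z" "l e = ([a], \<one>\<^bsub>?T\<^esub>)"
      using \<open>letter A a\<close> unfolding letter_def by blast
    have "awalk A [e] Z"
      using arc_implies_awalk[OF e(1)] e by simp
    moreover have "walk_label ?W l [e] = ([a], \<one>\<^bsub>?T\<^esub>)"
      by (simp add: walk_label_Cons walk_label_Nil e W_one W_mult)
    ultimately show ?thesis
      using \<open>a \<in> Sig\<close> by (auto simp: diagram_lang_iff)
  qed
  have push_lang: "u @ v \<in> ?L A"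
    if ABC: "A \<in> N" "B \<in> N" "C \<in> N" "push A B C" and u: "u \<in> ?L B" and v: "v \<in> ?L C" for A B C u v
  proof -
    obtain e where e: "e \<in> arcs H" "tail H e = A" "head H e = B" "l e = ([], T_elem N (Gen C))"
      using \<open>push A B C\<close> unfolding push_def by blast
    \<comment> \<open>Condition \<open>b\<close> turns the pushing arc \<open>e\<close> into an arc
      popping the same \<open>C\<close>; it joins the end \<open>Z\<close> of the walk from
      \<open>B\<close> to the start of the walk from \<open>C\<close>.\<close>
    obtain f where f: "f \<in> arcs H" "tail H f = Z" "head H f = C" "l f = ([], T_elem N (Primed C))"
      using b ABC e by blast
    obtain p where p: "awalk B p Z" "walk_label ?W l p = (u, \<one>\<^bsub>?T\<^esub>)"
      using u by (auto simp: diagram_lang_iff)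
    obtain q where q: "awalk C q Z" "walk_label ?W l q = (v, \<one>\<^bsub>?T\<^esub>)"
      using v by (auto simp: diagram_lang_iff)
    have fq: "awalk Z (f # q) Z" using q(1) f by (simp add: awalk_Cons_iff)
    have "awalk B (p @ f # q) Z"
      using awalk_appendI[OF p(1) fq] by simp
    then have "awalk A (e # p @ f # q) Z"
      using e by (metis awalk_Cons_iff)
    \<comment> \<open>Since \<open>p\<close> has trivial \<open>T\<close>-component, the pushed
      \<open>C\<close> meets the popped \<open>C\<close> directly and they cancel.\<close>
    moreover have "walk_label ?W l (e # p @ f # q) = (u @ v, \<one>\<^bsub>?T\<^esub>)"
    proof -
      have "walk_label ?W l (p @ f # q) = walk_label ?W l p \<otimes>\<^bsub>?W\<^esub> walk_label ?W l (f # q)"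
        using p(1) fq lab by (intro walk_label_append W.monoid_axioms) (auto simp: awalk_def)
      then show ?thesis
        using T_elem_in_carrier[OF \<open>C \<in> N\<close>] T_elem_relation[OF \<open>C \<in> N\<close>]
        by (simp add: walk_label_Cons e f p q W_mult)
    qed
    ultimately show ?thesis
      using u v by (auto simp: diagram_lang_iff)
  qed

  \<comment> \<open>The grammar, with nonterminals coded by natural numbers\<close>
  obtain f :: "'a \<Rightarrow> nat" where f: "inj_on f N"
    using finite_imp_inj_to_nat_seg[OF assms(1)] by blast
  define P where "P = {(f A, [Tm a]) | A a. A \<in> N \<and> a \<in> Sig \<and> letter A a} \<union>
    {(f A, [NT (f B), NT (f C)]) | A B C. A \<in> N \<and> B \<in> N \<and> C \<in> N \<and> push A B C}"
  define G where "G = \<lparr>nonterms = f ` N, terms = Sig, prods = P\<rparr>"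
  have "finite P"
  proof (rule finite_subset)
    show "P \<subseteq> (\<lambda>(A, a). (f A, [Tm a])) ` (N \<times> Sig) \<union>
        (\<lambda>(A, B, C). (f A, [NT (f B), NT (f C)])) ` (N \<times> N \<times> N)"
      unfolding P_def by force
  qed (use assms(1,3) in auto)
  then have wf: "wf_cfg G"
    using assms(1,3) by (auto simp: wf_cfg_def G_def P_def)

  \<comment> \<open>From walks to derivations\<close>
  define form :: "'a \<Rightarrow> 'a list \<Rightarrow> (nat, 'a) symbol list"
    where "form v st = map (\<lambda>A. NT (f A)) (if v = Z then st else v # st)" for v st
  \<comment> \<open>Induction on the remaining walk forces an arbitrary vertex \<open>v\<close> and
    stack \<open>st\<close>. The word \<open>t\<close> is any representative of the remaining label
    that empties \<open>st\<close>.\<close>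
  have walk_derives: "(derives_step G)\<^sup>*\<^sup>* (form v st) (map Tm \<alpha>)"
    if "awalk v p Z" "walk_label ?W l p = (\<alpha>, ?cls t)" "t \<in> lists (T_gens N)"
      "stack_run t st = Some []" for v p \<alpha> t st
    using that
  proof (induction p arbitrary: v \<alpha> t st)
    case Nil
    then have "v = Z" "\<alpha> = []" "?cls [] = ?cls t"
      by (auto simp: awalk_Nil_iff walk_label_Nil W_one pres_class_T_one)
    moreover from this have "stack_run t st = Some st"
      using stack_run_class[of t N "[]" st] Nil.prems(3) by simp
    ultimately show ?case
      using Nil.prems(4) by (simp add: form_def)
  next
    case (Cons e p)
    have e: "e \<in> arcs H" "tail H e = v" and p: "awalk (head H e) p Z"
      using Cons.prems(1) by (auto simp: awalk_Cons_iff)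
    have "walk_label ?W l p \<in> carrier ?W"
      using p lab by (intro walk_label_closed W.monoid_axioms) (auto simp: awalk_def)
    then obtain \<beta> s where \<beta>: "walk_label ?W l p = (\<beta>, ?cls s)" and s: "s \<in> lists (T_gens N)"
      by (rule W_carrierE)
    have IH: "(derives_step G)\<^sup>*\<^sup>* (form (head H e) st') (map Tm \<beta>)"
      if "stack_run s st' = Some []" for st'
      by (rule Cons.IH[OF p \<beta> s that])
    have label: "l e \<otimes>\<^bsub>?W\<^esub> (\<beta>, ?cls s) = (\<alpha>, ?cls t)"
      using Cons.prems(2) \<beta> by (simp add: walk_label_Cons)
    \<comment> \<open>The word \<open>t\<close> need not begin with \<open>g\<close>. It only
      represents the same element as \<open>g # s\<close>, which suffices for both to act alike on
      \<open>st\<close>.\<close>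
    have gen_step: "\<alpha> = \<beta>" "stack_run (g # s) st = Some []"
      if "g \<in> T_gens N" "l e = ([], T_elem N g)" for g
      using label that s Cons.prems(3,4) stack_run_class[of t N "g # s" st]
      by (auto simp: W_mult pres_class_T_Cons)
    consider (letter) "v \<in> N" "head H e = Z"
      | (push) B C where "v \<in> N" "B \<in> N" "C \<in> N" "head H e = B" "l e = ([], T_elem N (Gen C))"
      | (pop) C where "C \<in> N" "v = Z" "head H e = C" "l e = ([], T_elem N (Primed C))"
      using c e by blast
    then show ?case
    proof cases
      case letter
      then obtain a where a: "a \<in> Sig" "l e = ([a], \<one>\<^bsub>?T\<^esub>)"
        using a e by blast
      have "?cls s \<in> carrier ?T"
        using s by (simp add: T_monoid_def carrier_pres_monoid)
      then have \<alpha>: "\<alpha> = a # \<beta>" and "?cls s = ?cls t"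
        using label by (simp_all add: a W_mult)
      then have "stack_run s st = Some []"
        using stack_run_class[of t N s st] s Cons.prems(3,4) by simp
      then have "(derives_step G)\<^sup>*\<^sup>* ([Tm a] @ form Z st @ []) ([Tm a] @ map Tm \<beta> @ [])"
        using IH letter by (intro derives_context) simp
      moreover have "(f v, [Tm a]) \<in> prods G"
        using letter a e unfolding G_def P_def letter_def by auto
      ultimately have "(derives_step G)\<^sup>*\<^sup>* (NT (f v) # form Z st) (map Tm \<alpha>)"
        using \<alpha> by (intro derives_production) auto
      then show ?thesis
        using letter ZN by (auto simp: form_def)
    next
      case push
      then have "\<alpha> = \<beta>" "stack_run s (C # st) = Some []"
        using gen_step[of "Gen C"] by (auto simp: T_gens_def)
      then have "(derives_step G)\<^sup>*\<^sup>* (form B (C # st)) (map Tm \<alpha>)"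
        using IH push by simp
      moreover have "(f v, [NT (f B), NT (f C)]) \<in> prods G"
        using push e unfolding G_def P_def push_def by auto
      \<comment> \<open>The pushed \<open>C\<close> stands right after the new vertex
        \<open>B\<close>, exactly where the production \<open>A \<rightarrow> B C\<close> puts
        it.\<close>
      moreover have "form B (C # st) = [NT (f B), NT (f C)] @ form Z st"
        using push ZN by (auto simp: form_def)
      ultimately have "(derives_step G)\<^sup>*\<^sup>* (NT (f v) # form Z st) (map Tm \<alpha>)"
        by (intro derives_production) auto
      then show ?thesis
        using push ZN by (auto simp: form_def)
    next
      case pop
      then have "\<alpha> = \<beta>" "stack_run (Primed C # s) st = Some []"
        using gen_step[of "Primed C"] by (auto simp: T_gens_def)
      moreover have "C \<noteq> Z"
        using pop ZN by blast
      \<comment> \<open>A defined pop forces \<open>C\<close> on top of \<open>st\<close>. Then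
        \<open>form Z st\<close> and \<open>form C st'\<close> coincide: a popping arc applies no
        production, it only makes the next pending nonterminal the current vertex.\<close>
      moreover from calculation obtain st' where "st = C # st'" "stack_run s st' = Some []"
        by (cases st) (auto split: if_splits)
      ultimately show ?thesis
        using IH[of st'] pop by (simp add: form_def)
    qed
  qed

  define L where "L n = ?L (inv_into N f n)" for n
  have Lf: "L (f A) = ?L A" if "A \<in> N" for A
    using that f by (simp add: L_def)
  have closed: "form_lang L w \<subseteq> L A" if "(A, w) \<in> prods G" for A w
    using that by (auto simp: G_def P_def Lf letter_lang push_lang)

  have "?L S = cfg_lang G (f S)"
  proof (intro equalityI subsetI)
    fix \<alpha> assume "\<alpha> \<in> ?L S"
    then obtain p where "\<alpha> \<in> lists Sig" "awalk S p Z" "walk_label ?W l p = (\<alpha>, ?cls [])"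
      by (auto simp: diagram_lang_iff pres_class_T_one)
    \<comment> \<open>The representative \<open>[]\<close> of the identity takes the empty stack to
      itself, so \<open>walk_derives\<close> applies with \<open>st = []\<close>.\<close>
    moreover from this have "(derives_step G)\<^sup>*\<^sup>* (form S []) (map Tm \<alpha>)"
      by (intro walk_derives) auto
    moreover have "form S [] = [NT (f S)]"
      using \<open>S \<in> N\<close> ZN by (auto simp: form_def)
    ultimately show "\<alpha> \<in> cfg_lang G (f S)"
      by (simp add: cfg_lang_def G_def)
  next
    fix \<alpha> assume "\<alpha> \<in> cfg_lang G (f S)"
    then have "form_lang L (map Tm \<alpha>) \<subseteq> form_lang L [NT (f S)]"
      by (intro form_lang_derives[of G] closed) (simp_all add: cfg_lang_def)
    then show "\<alpha> \<in> ?L S"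
      using \<open>S \<in> N\<close> by (simp add: form_lang_terminals Lf)
  qed
  moreover have "f S \<in> nonterms G"
    using \<open>S \<in> N\<close> by (simp add: G_def)
  ultimately show ?thesis
    using wf unfolding context_free_def by blast
qed

end
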